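(* Let $X$ be a nonempty locally compact Hausdorff space and let $Y$ be a locally convex topological vector space over $\mathbb{R}$ or $\mathbb{C}$ with at least two points, equipped with a compatible metric $d$. Suppose that $Y$ is separable. The following conditions are equivalent: (1) $MC(X,Y)$ is ccc; (2) $MC(X,Y)$ is locally ccc; (3) $X$ is discrete.
   Context: A map (multifunction) $F\colon X\to Y$ assigns to each $x\in X$ a subset $F(x)\subseteq Y$; for $A\subseteq X$ put $F(A)=\bigcup_{x\in A}F(x)$. Maps are identified with their graphs $\{(x,y): y\in F(x)\}$. $F$ is upper semicontinuous if for every $x\in X$ and every open $V\supseteq F(x)$ there is an open $U\ni x$ with $F(U)\subseteq V$. $F$ is usco if it is upper semicontinuous and every $F(x)$ is a nonempty compact set. $F$ is cusco if it is usco and every $F(x)$ is convex. $F$ is minimal cusco if it is cusco and its graph does not properly contain the graph of any other cusco map from $X$ to $Y$. $MC(X,Y)$ is the set of all minimal cusco maps from $X$ to $Y$. Let $K(Y)$ be the set of nonempty compact subsets of $Y$, and $H_d$ the Hausdorff metric on $K(Y)$. On $K(Y)^X$ the topology $\tau_{uc}$ of uniform convergence on compact sets is induced by the uniformity $\mathcal U_{uc}$ with base consisting of the sets $W[K,\varepsilon]=\{(F,G): H_d(F(x),G(x))<\varepsilon \text{ for every } x\in K\}$, where $K\subseteq X$ is compact and $\varepsilon>0$. $MC(X,Y)\subseteq K(Y)^X$ carries the subspace topology of $\tau_{uc}$. A space $Z$ is ccc if every family of pairwise disjoint open subsets of $Z$ is countable; $Z$ is locally ccc if every $z\in Z$ has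 a neighborhood which is a ccc subspace of $Z$. *)

theory Defs
  imports "HOL-Analysis.Analysis"
begin

text \<open>
  The scalar fields: a real normed field that is one-dimensional, or of the form
  \<open>\<real> + \<real> i\<close> with \<open>i\<^sup>2 = -1\<close>. Multiplicativity of the norm forces the norm to be the
  usual absolute value, so the only instances are, up to isomorphism, \<^typ>\<open>real\<close> and
  \<^typ>\<open>complex\<close>.
\<close>

class real_or_complex = real_normed_field +
  assumes real_or_complex:
    "(\<forall>z. \<exists>a. z = a *\<^sub>R 1) \<or> (\<exists>i. i * i = - 1 \<and> (\<forall>z. \<exists>a b. z = a *\<^sub>R 1 + b *\<^sub>R i))"

instance real :: real_or_complex
  by standard simp

instance complex :: real_or_complex
proof
  have "z = Re z *\<^sub>R 1 + Im z *\<^sub>R \<i>" for z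
    by (simp add: complex_eq_iff)
  then have "\<i> * \<i> = - 1 \<and> (\<forall>z. \<exists>a b. z = a *\<^sub>R 1 + b *\<^sub>R \<i>)"
    by (metis i_squared)
  then show "(\<forall>z::complex. \<exists>a. z = a *\<^sub>R 1) \<or>
      (\<exists>i::complex. i * i = - 1 \<and> (\<forall>z. \<exists>a b. z = a *\<^sub>R 1 + b *\<^sub>R i))"
    by blast
qed

text \<open>
  The type class \<^class>\<open>real_vector\<close> provides the underlying real vector space, which is
  all that convexity depends on; \<open>scale_of_real\<close> says that it is obtained from \<open>scale\<close> by
  restriction of scalars.
\<close>

locale locally_convex_tvs = vector_space scale
  for scale :: "'k::real_or_complex \<Rightarrow> 'b::{real_vector, topological_space} \<Rightarrow> 'b" +
  assumes scale_of_real: "scale (of_real r) y = r *\<^sub>R y"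
    and continuous_add: "continuous_on UNIV (\<lambda>(x, y). x + y :: 'b)"
    and continuous_scale: "continuous_on UNIV (\<lambda>(c, y). scale c y)"
    and locally_convex: "neighbourhood_base_at 0 convex (euclidean :: 'b topology)"

definition map_graph :: "('a \<Rightarrow> 'b set) \<Rightarrow> ('a \<times> 'b) set"
  where "map_graph F = {(x, y). y \<in> F x}"

definition upper_semicontinuous :: "('a::topological_space \<Rightarrow> 'b::topological_space set) \<Rightarrow> bool"
  where "upper_semicontinuous F \<longleftrightarrow>
    (\<forall>x V. open V \<and> F x \<subseteq> V \<longrightarrow> (\<exists>U. open U \<and> x \<in> U \<and> (\<Union>x'\<in>U. F x') \<subseteq> V))"

definition usco :: "('a::topological_space \<Rightarrow> 'b::topological_space set) \<Rightarrow> bool"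
  where "usco F \<longleftrightarrow> upper_semicontinuous F \<and> (\<forall>x. F x \<noteq> {} \<and> compact (F x))"

definition cusco :: "('a::topological_space \<Rightarrow> 'b::{real_vector, topological_space} set) \<Rightarrow> bool"
  where "cusco F \<longleftrightarrow> usco F \<and> (\<forall>x. convex (F x))"

definition minimal_cusco ::
    "('a::topological_space \<Rightarrow> 'b::{real_vector, topological_space} set) \<Rightarrow> bool"
  where "minimal_cusco F \<longleftrightarrow> cusco F \<and> \<not> (\<exists>G. cusco G \<and> map_graph G \<subset> map_graph F)"

definition MC :: "('a::topological_space \<Rightarrow> 'b::{real_vector, topological_space} set) set"
  where "MC = {F. minimal_cusco F}"

text \<open>Only meaningful for nonempty bounded sets (otherwise the suprema below are unspecified).\<close>

definition Hausdorff_dist :: "'b::metric_space set \<Rightarrow> 'b set \<Rightarrow> real"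
  where "Hausdorff_dist A B = max (SUP a\<in>A. infdist a B) (SUP b\<in>B. infdist b A)"

definition compact_valued_maps :: "('a \<Rightarrow> 'b::topological_space set) set"
  where "compact_valued_maps = {F. \<forall>x. F x \<noteq> {} \<and> compact (F x)}"

definition uc_entourage ::
    "'a set \<Rightarrow> real \<Rightarrow> (('a \<Rightarrow> 'b::metric_space set) \<times> ('a \<Rightarrow> 'b set)) set"
  where "uc_entourage K \<epsilon> =
    {(F, G). F \<in> compact_valued_maps \<and> G \<in> compact_valued_maps \<and>
      (\<forall>x\<in>K. Hausdorff_dist (F x) (G x) < \<epsilon>)}"

text \<open>
  The topology induced by the uniformity with base \<^const>\<open>uc_entourage\<close>; its carrier is
  \<^const>\<open>compact_valued_maps\<close>.
\<close>

definition uc_topology :: "('a::topological_space \<Rightarrow> 'b::metric_space set) topology"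
  where "uc_topology = topology (\<lambda>\<U>. \<U> \<subseteq> compact_valued_maps \<and>
    (\<forall>F\<in>\<U>. \<exists>K \<epsilon>. compact K \<and> \<epsilon> > 0 \<and> uc_entourage K \<epsilon> `` {F} \<subseteq> \<U>))"

lemma uc_entourage_Int:
  "uc_entourage (K \<union> L) (min \<epsilon> \<delta>) \<subseteq> uc_entourage K \<epsilon> \<inter> uc_entourage L \<delta>"
  by (auto simp: uc_entourage_def)

lemma openin_uc_topology:
  "openin uc_topology \<U> \<longleftrightarrow> \<U> \<subseteq> compact_valued_maps \<and>
    (\<forall>F\<in>\<U>. \<exists>K \<epsilon>. compact K \<and> \<epsilon> > 0 \<and> uc_entourage K \<epsilon> `` {F} \<subseteq> \<U>)"
proof -
  have "istopology (\<lambda>\<U> :: ('a \<Rightarrow> 'b set) set. \<U> \<subseteq> compact_valued_maps \<and>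
    (\<forall>F\<in>\<U>. \<exists>K \<epsilon>. compact K \<and> \<epsilon> > 0 \<and> uc_entourage K \<epsilon> `` {F} \<subseteq> \<U>))" (is "istopology ?P")
    unfolding istopology_def
  proof (intro conjI allI impI)
    fix S T assume S: "?P S" and T: "?P T"
    show "S \<inter> T \<subseteq> compact_valued_maps" using S by blast
    show "\<forall>F\<in>S \<inter> T. \<exists>K \<epsilon>. compact K \<and> \<epsilon> > 0 \<and> uc_entourage K \<epsilon> `` {F} \<subseteq> S \<inter> T"
    proof
      fix F assume "F \<in> S \<inter> T"
      then obtain K \<epsilon> L \<delta> where
        "compact K" "\<epsilon> > 0" "uc_entourage K \<epsilon> `` {F} \<subseteq> S"
        "compact L" "\<delta> > 0" "uc_entourage L \<delta> `` {F} \<subseteq> T"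
        using S T by (meson IntD1 IntD2)
      moreover have "uc_entourage (K \<union> L) (min \<epsilon> \<delta>) `` {F} \<subseteq>
          uc_entourage K \<epsilon> `` {F} \<inter> uc_entourage L \<delta> `` {F}"
        using uc_entourage_Int[of K L \<epsilon> \<delta>] by blast
      ultimately have "compact (K \<union> L) \<and> min \<epsilon> \<delta> > 0 \<and>
          uc_entourage (K \<union> L) (min \<epsilon> \<delta>) `` {F} \<subseteq> S \<inter> T"
        by (auto intro: compact_Un)
      then show "\<exists>K \<epsilon>. compact K \<and> \<epsilon> > 0 \<and> uc_entourage K \<epsilon> `` {F} \<subseteq> S \<inter> T"
        by blast
    qed
  next
    fix \<K> assume K: "\<forall>S\<in>\<K>. ?P S"
    show "\<Union>\<K> \<subseteq> compact_valued_maps" using K by blast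
    show "\<forall>F\<in>\<Union>\<K>. \<exists>K \<epsilon>. compact K \<and> \<epsilon> > 0 \<and> uc_entourage K \<epsilon> `` {F} \<subseteq> \<Union>\<K>"
    proof
      fix F assume "F \<in> \<Union>\<K>"
      then obtain S where "S \<in> \<K>" "F \<in> S" by blast
      then obtain K \<epsilon> where "compact K" "\<epsilon> > 0" "uc_entourage K \<epsilon> `` {F} \<subseteq> S"
        using K by meson
      then show "\<exists>K \<epsilon>. compact K \<and> \<epsilon> > 0 \<and> uc_entourage K \<epsilon> `` {F} \<subseteq> \<Union>\<K>"
        using \<open>S \<in> \<K>\<close> by (meson Union_upper subset_trans)
    qed
  qed
  then show ?thesis
    by (simp add: uc_topology_def)
qed

lemma topspace_uc_topology: "topspace uc_topology = compact_valued_maps"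
proof
  show "topspace uc_topology \<subseteq> compact_valued_maps"
    using openin_topspace openin_uc_topology by blast
  have "openin uc_topology compact_valued_maps"
    unfolding openin_uc_topology uc_entourage_def
    by (auto intro!: exI[of _ "{}"] exI[of _ "1::real"])
  then show "compact_valued_maps \<subseteq> topspace uc_topology"
    by (rule openin_subset)
qed

lemma MC_subset_compact_valued_maps: "MC \<subseteq> compact_valued_maps"
  by (auto simp: MC_def minimal_cusco_def cusco_def usco_def compact_valued_maps_def)

definition MC_space ::
    "('a::topological_space \<Rightarrow> 'b::{real_vector, metric_space} set) topology"
  where "MC_space = subtopology uc_topology MC"

definition ccc_space :: "'a topology \<Rightarrow> bool"
  where "ccc_space Z \<longleftrightarrow> (\<forall>\<U>. (\<forall>U\<in>\<U>. openin Z U) \<and> pairwise disjnt \<U> \<longrightarrow> countable \<U>)"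

definition locally_ccc_space :: "'a topology \<Rightarrow> bool"
  where "locally_ccc_space Z \<longleftrightarrow> (\<forall>z\<in>topspace Z.
    \<exists>U N. openin Z U \<and> z \<in> U \<and> U \<subseteq> N \<and> N \<subseteq> topspace Z \<and> ccc_space (subtopology Z N))"

end

theory Submission
  imports Defs "HOL-Probability.Infinite_Product_Measure"
    "HOL-Probability.Probability_Mass_Function"
begin

text \<open>
  Two constructions carry the proof; that ccc implies locally ccc is immediate.

  \<^emph>\<open>Discrete implies ccc.\<close> On a discrete space every selection of a cusco map is continuous, so
  by minimality the minimal cusco maps are exactly the maps \<open>x \<mapsto> {f x}\<close> with \<open>f\<close> arbitrary
  (\<open>MC_discrete_singletons\<close>), and compact sets are finite. With a dense sequence \<open>d\<close> in \<open>Y\<close>, the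
  map \<open>g \<mapsto> (x \<mapsto> {d (g x)})\<close> on functions \<open>g : X \<rightarrow> \<nat>\<close> therefore pulls every nonempty open set of
  minimal cusco maps back to a set that contains a finite cylinder
  \<open>{g. \<forall>x\<in>K. g x = n x}\<close>. A product of fully supported probability measures on \<open>\<nat>\<close>
  gives each finite cylinder positive mass, however large \<open>X\<close> is. Disjoint sets of positive mass in
  a probability space are countable in number (\<open>countable_disjoint_cylinders\<close>), so a disjoint
  family of open sets is countable. The measure replaces the usual combinatorial argument with
  \<open>\<Delta>\<close>-systems.

  \<^emph>\<open>Locally ccc implies discrete.\<close> For an open set \<open>G\<close> of \<open>X\<close> and a vector \<open>y\<close>, let the map
  \<open>jump_map y G\<close> take the value \<open>{y}\<close> in the interior of \<open>closure G\<close>, the value \<open>{0}\<close> outside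
  \<open>closure G\<close>, and the whole segment from \<open>0\<close> to \<open>y\<close> on the boundary of \<open>closure G\<close>. It is a minimal cusco map
  (\<open>minimal_cusco_jump_map\<close>). If some point of \<open>X\<close> is not isolated, a compact neighbourhood of it
  contains an infinite sequence of disjoint nonempty open sets \<open>V n\<close>. For \<open>A \<subseteq> \<nat>\<close> take
  \<open>G\<close> to be the union of the \<open>V n\<close> with \<open>n \<in> A\<close>. When \<open>y\<close> is a small nonzero vector, all these
  maps are uniformly close to the constant map \<open>x \<mapsto> {0}\<close>, hence lie in any prescribed neighbourhood
  of it; but any two of them, for different \<open>A\<close>, take the values \<open>{y}\<close> and
  \<open>{0}\<close> at some point of the compact neighbourhood. This
  places uncountably many disjoint open sets inside every neighbourhood of a single minimal cusco map.
\<close>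

section \<open>Finite cylinders in a power of the natural numbers\<close>

text \<open>The measures of the members of the family are summable, because every finite partial sum is
  the measure of a disjoint union; and a summable family of reals has countable support.\<close>

lemma (in finite_measure) countable_disjoint_family_measure_pos:
  assumes disj: "disjoint_family_on C I"
    and sets: "\<And>i. i \<in> I \<Longrightarrow> C i \<in> sets M"
    and pos: "\<And>i. i \<in> I \<Longrightarrow> measure M (C i) > 0"
  shows "countable I"
proof -
  have bound: "(\<Sum>i\<in>J. measure M (C i)) \<le> measure M (space M)" if "finite J" "J \<subseteq> I" for J
  proof -
    have "(\<Sum>i\<in>J. measure M (C i)) = measure M (\<Union>i\<in>J. C i)"
      using that disj sets
      by (intro finite_measure_finite_Union[symmetric]) (auto simp: disjoint_family_on_def)
    then show ?thesis
      by (simp add: bounded_measure)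
  qed
  have "(\<lambda>i. measure M (C i)) summable_on I"
    by (rule nonneg_bdd_above_summable_on) (auto intro!: bdd_aboveI2 bound)
  then have "countable {i\<in>I. measure M (C i) \<noteq> 0}"
    by (rule summable_countable_real)
  moreover have "{i\<in>I. measure M (C i) \<noteq> 0} = I"
    using pos by force
  ultimately show ?thesis
    by simp
qed

definition cylinder :: "'a set \<Rightarrow> ('a \<Rightarrow> 'b) \<Rightarrow> ('a \<Rightarrow> 'b) set"
  where "cylinder K f = {g. \<forall>x\<in>K. g x = f x}"

text \<open>This is the countable chain condition for the product topology on \<open>'a \<Rightarrow> nat\<close>. Under a
  product measure, a cylinder over a finite set has as its mass a finite product of point masses,
  which is positive once every natural number has positive mass. The index set of the product
  may be arbitrarily large.\<close>

lemma countable_disjoint_cylinders: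
  fixes f :: "'i \<Rightarrow> 'a \<Rightarrow> nat"
  assumes fin: "\<And>i. i \<in> I \<Longrightarrow> finite (K i)"
    and disj: "disjoint_family_on (\<lambda>i. cylinder (K i) (f i)) I"
  shows "countable I"
proof -
  \<comment> \<open>Any distribution on the natural numbers with full support serves here.\<close>
  define N :: "'a \<Rightarrow> nat measure" where "N = (\<lambda>_. measure_pmf (geometric_pmf (1/2)))"
  interpret product_prob_space N UNIV
    by (rule product_prob_spaceI) (simp add: N_def measure_pmf.prob_space_axioms)
  have cyl: "prod_emb UNIV N (K i) (\<Pi>\<^sub>E x\<in>K i. {f i x}) = cylinder (K i) (f i)" for i
    by (auto simp: prod_emb_def cylinder_def N_def PiE_iff restrict_def extensional_def)
  show ?thesis
  proof (rule countable_disjoint_family_measure_pos[OF disj])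
    fix i assume "i \<in> I"
    then have K: "finite (K i)"
      by (rule fin)
    then show "cylinder (K i) (f i) \<in> sets (Pi\<^sub>M UNIV N)"
      by (subst cyl[symmetric], intro sets_PiM_I) (auto simp: N_def)
    have "measure (Pi\<^sub>M UNIV N) (cylinder (K i) (f i)) = (\<Prod>x\<in>K i. measure (N x) {f i x})"
      using K by (subst cyl[symmetric], intro measure_PiM_emb) (auto simp: N_def)
    also have "\<dots> > 0"
      by (intro prod_pos) (auto simp: N_def measure_pmf_single)
    finally show "measure (Pi\<^sub>M UNIV N) (cylinder (K i) (f i)) > 0" .
  qed
qed


section \<open>Uniform convergence on compact sets\<close>

lemma Hausdorff_dist_le:
  assumes "A \<noteq> {}" "B \<noteq> {}" "\<And>a b. a \<in> A \<Longrightarrow> b \<in> B \<Longrightarrow> dist a b \<le> r"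
  shows "Hausdorff_dist A B \<le> r"
proof -
  have "infdist a B \<le> r" if "a \<in> A" for a
    using assms that by (meson ex_in_conv infdist_le order_trans)
  moreover have "infdist b A \<le> r" if "b \<in> B" for b
    using assms that by (metis dist_commute ex_in_conv infdist_le order_trans)
  ultimately show ?thesis
    unfolding Hausdorff_dist_def using assms by (auto intro!: cSUP_least)
qed

text \<open>Compactness of \<open>B\<close> keeps the supremum in the definition of the Hausdorff distance bounded,
  so that it dominates each of the distances \<open>infdist b A\<close>.\<close>

lemma Hausdorff_dist_less_imp_close:
  assumes "compact B" "A \<noteq> {}" "b \<in> B" "Hausdorff_dist A B < \<delta>"
  obtains a where "a \<in> A" "dist a b < \<delta>"
proof -
  have "bdd_above ((\<lambda>b. infdist b A) ` B)"
    using assms(1) by (intro bounded_imp_bdd_above compact_imp_bounded compact_continuous_image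
        continuous_intros)
  then have "infdist b A \<le> (SUP b\<in>B. infdist b A)"
    using assms(3) by (intro cSUP_upper)
  then have "infdist b A < \<delta>"
    using assms(4) by (simp add: Hausdorff_dist_def)
  then have "(INF a\<in>A. dist b a) < \<delta>"
    using assms(2) by (simp add: infdist_def)
  then obtain a where "a \<in> A" "dist b a < \<delta>"
    using assms(2) by (subst (asm) cINF_less_iff) auto
  then show ?thesis
    using that by (simp add: dist_commute)
qed

lemma openin_MC_spaceE:
  assumes "openin MC_space U" "F \<in> U"
  obtains K \<epsilon> where "compact K" "\<epsilon> > 0"
    "\<And>G. G \<in> MC \<Longrightarrow> (\<And>x. x \<in> K \<Longrightarrow> Hausdorff_dist (F x) (G x) < \<epsilon>) \<Longrightarrow> G \<in> U"
proof -
  obtain S where S: "openin uc_topology S" "U = S \<inter> MC"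
    using assms(1) unfolding MC_space_def openin_subtopology by blast
  then obtain K \<epsilon> where K: "compact K" "\<epsilon> > 0" "uc_entourage K \<epsilon> `` {F} \<subseteq> S"
    using assms(2) unfolding openin_uc_topology by blast
  show ?thesis
  proof
    fix G :: "'a \<Rightarrow> 'b set"
    assume G: "G \<in> MC" "\<And>x. x \<in> K \<Longrightarrow> Hausdorff_dist (F x) (G x) < \<epsilon>"
    then have "(F, G) \<in> uc_entourage K \<epsilon>"
      using assms(2) S(2) MC_subset_compact_valued_maps by (auto simp: uc_entourage_def)
    then show "G \<in> U"
      using K(3) S(2) G(1) by blast
  qed (use K in auto)
qed

lemma topspace_MC_space: "topspace MC_space = MC"
  using MC_subset_compact_valued_maps
  by (auto simp: MC_space_def topspace_subtopology topspace_uc_topology)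

text \<open>Requiring all points of \<open>G x\<close> to be at distance less than \<open>r\<close> from \<open>f x\<close>, with a margin
  \<open>\<delta>\<close> that is uniform in \<open>x\<close>, makes the set open in the topology of uniform convergence: the
  basic entourage neighbourhoods of a map need not themselves be open. Comparing with a
  point-valued function \<open>f\<close> is enough to separate maps, and makes the triangle inequality of the
  underlying metric sufficient.\<close>

definition uniform_tube :: "'a set \<Rightarrow> real \<Rightarrow> ('a \<Rightarrow> 'b::metric_space) \<Rightarrow> ('a \<Rightarrow> 'b set) set"
  where "uniform_tube S r f = {G \<in> compact_valued_maps.
    \<exists>\<delta>>0. \<forall>x\<in>S. \<forall>p\<in>G x. dist p (f x) \<le> r - \<delta>}"

text \<open>Moving a map by less than half of its margin, uniformly on \<open>L\<close>, leaves half of the margin. In the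
  application \<open>S\<close> is an infinite discrete set, hence not compact, inside a compact set \<open>L\<close>.\<close>

lemma openin_uniform_tube:
  fixes f :: "'a::topological_space \<Rightarrow> 'b::metric_space"
  assumes "S \<subseteq> L" "compact L"
  shows "openin uc_topology (uniform_tube S r f)"
  unfolding openin_uc_topology
proof (intro conjI ballI)
  fix F :: "'a \<Rightarrow> 'b set" assume "F \<in> uniform_tube S r f"
  then obtain \<delta> where F: "F \<in> compact_valued_maps" and \<delta>: "\<delta> > 0"
    and tube: "\<And>x q. x \<in> S \<Longrightarrow> q \<in> F x \<Longrightarrow> dist q (f x) \<le> r - \<delta>"
    by (auto simp: uniform_tube_def)
  have "G \<in> uniform_tube S r f" if "(F, G) \<in> uc_entourage L (\<delta>/2)" for G
  proof -
    have G: "G \<in> compact_valued_maps" "\<And>x. x \<in> L \<Longrightarrow> Hausdorff_dist (F x) (G x) < \<delta>/2"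
      using that by (auto simp: uc_entourage_def)
    have "dist p (f x) \<le> r - \<delta>/2" if "x \<in> S" "p \<in> G x" for x p
    proof -
      have "compact (G x)" "F x \<noteq> {}" "Hausdorff_dist (F x) (G x) < \<delta>/2"
        using F G \<open>x \<in> S\<close> assms(1) by (auto simp: compact_valued_maps_def)
      then obtain q where "q \<in> F x" "dist q p < \<delta>/2"
        using \<open>p \<in> G x\<close> by (metis Hausdorff_dist_less_imp_close)
      then show ?thesis
        using tube[OF \<open>x \<in> S\<close>, of q] dist_triangle[of p "f x" q]
        by (simp add: dist_commute)
    qed
    then show ?thesis
      using G(1) \<delta> unfolding uniform_tube_def by (auto intro!: exI[of _ "\<delta>/2"])
  qed
  then show "\<exists>K \<epsilon>. compact K \<and> \<epsilon> > 0 \<and> uc_entourage K \<epsilon> `` {F} \<subseteq> uniform_tube S r f"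
    using assms(2) \<delta> by (intro exI[of _ L] exI[of _ "\<delta>/2"]) auto
qed (auto simp: uniform_tube_def)


section \<open>Minimal cusco maps on a discrete space\<close>

lemma minimal_cusco_singletons:
  fixes g :: "'a::topological_space \<Rightarrow> 'b::{real_vector, metric_space}"
  assumes "continuous_on UNIV g"
  shows "minimal_cusco (\<lambda>x. {g x})"
  unfolding minimal_cusco_def
proof
  have "\<exists>U. open U \<and> x \<in> U \<and> (\<Union>x'\<in>U. {g x'}) \<subseteq> V" if "open V \<and> {g x} \<subseteq> V" for x V
    using that assms by (intro exI[of _ "g -` V"]) (auto intro: open_vimage)
  then show "cusco (\<lambda>x. {g x})"
    by (auto simp: cusco_def usco_def upper_semicontinuous_def)
  show "\<not> (\<exists>G. cusco G \<and> map_graph G \<subset> map_graph (\<lambda>x. {g x}))"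
  proof (rule notI, elim exE conjE)
    fix G assume G: "cusco G" "map_graph G \<subset> map_graph (\<lambda>x. {g x})"
    have "G x = {g x}" for x
    proof -
      have "G x \<subseteq> {g x}"
        using G(2) by (auto simp: map_graph_def)
      moreover have "G x \<noteq> {}"
        using G(1) by (simp add: cusco_def usco_def)
      ultimately show ?thesis by blast
    qed
    then show False
      using G(2) by (simp add: map_graph_def)
  qed
qed

text \<open>Any selection \<open>f\<close> of \<open>F\<close> is continuous, so \<open>x \<mapsto> {f x}\<close> is a cusco map inside \<open>F\<close>, and
  minimality forces equality.\<close>

lemma MC_discrete_singletons:
  fixes F :: "'a::topological_space \<Rightarrow> 'b::{real_vector, metric_space} set"
  assumes discrete: "\<And>S :: 'a set. open S" and F: "F \<in> MC"
  obtains f where "F = (\<lambda>x. {f x})"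
proof -
  have F': "minimal_cusco F"
    using F by (simp add: MC_def)
  then have "\<forall>x. \<exists>y. y \<in> F x"
    by (metis cusco_def ex_in_conv minimal_cusco_def usco_def)
  then obtain f where f: "\<And>x. f x \<in> F x"
    by metis
  have "continuous_on UNIV f"
    by (simp add: continuous_on_open_vimage discrete)
  then have "cusco (\<lambda>x. {f x})"
    using minimal_cusco_singletons minimal_cusco_def by blast
  moreover have "map_graph (\<lambda>x. {f x}) \<subseteq> map_graph F"
    using f by (auto simp: map_graph_def)
  ultimately have "map_graph (\<lambda>x. {f x}) = map_graph F"
    using F' unfolding minimal_cusco_def by blast
  then have "F = (\<lambda>x. {f x})"
    by (auto simp: map_graph_def set_eq_iff fun_eq_iff)
  then show ?thesis
    by (rule that)
qed

text \<open>A basic neighbourhood of \<open>x \<mapsto> {f x}\<close> constrains a map only on a finite set \<open>K\<close>. Approximating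
  \<open>f\<close> on \<open>K\<close> by members of a dense sequence \<open>d\<close> turns the neighbourhood into a finite cylinder of
  functions \<open>g\<close>, where \<open>g x\<close> is the index of the chosen member of the sequence at \<open>x\<close>.\<close>

lemma discrete_imp_ccc_MC_space:
  assumes discrete: "\<And>S :: 'a::topological_space set. open S"
    and separable: "separable_space (euclidean :: 'b::{real_vector, metric_space} topology)"
  shows "ccc_space (MC_space :: ('a \<Rightarrow> 'b set) topology)"
  unfolding ccc_space_def
proof (intro allI impI, elim conjE)
  fix \<U> :: "('a \<Rightarrow> 'b set) set set"
  assume op: "\<forall>U\<in>\<U>. openin MC_space U" and disj: "pairwise disjnt \<U>"
  obtain D :: "'b set" where D: "countable D" "closure D = UNIV"
    using separable by (auto simp: separable_space_def)
  define d where "d = from_nat_into D"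
  have "D \<noteq> {}"
    using D(2) by auto
  then have approx: "\<exists>n. dist (d n) y < \<epsilon>" if "\<epsilon> > 0" for y \<epsilon>
    using D that closure_approachable[of y D] by (metis UNIV_I d_def from_nat_into_surj)
  \<comment> \<open>The empty set is left aside, as it contains the image of no cylinder.\<close>
  have "\<exists>K n. finite K \<and> (\<forall>g\<in>cylinder K n. (\<lambda>x. {d (g x)}) \<in> U)"
    if "U \<in> \<U> - {{}}" for U
  proof -
    have "U \<noteq> {}" and U: "openin MC_space U"
      using that op by auto
    then obtain F where F: "F \<in> U"
      by blast
    then have "F \<in> MC"
      using U openin_subset topspace_MC_space by blast
    then obtain f where f: "F = (\<lambda>x. {f x})"
      using MC_discrete_singletons[OF discrete] by metis
    obtain K \<epsilon> where K: "compact K" "\<epsilon> > 0"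
      "\<And>G. G \<in> MC \<Longrightarrow> (\<And>x. x \<in> K \<Longrightarrow> Hausdorff_dist (F x) (G x) < \<epsilon>) \<Longrightarrow> G \<in> U"
      using openin_MC_spaceE[OF U F] by metis
    have "finite K"
    proof -
      have "K \<subseteq> \<Union>(range (\<lambda>x. {x}))"
        by blast
      then obtain \<D> where "\<D> \<subseteq> range (\<lambda>x. {x})" "finite \<D>" "K \<subseteq> \<Union>\<D>"
        using K(1) discrete by (meson compact_eq_Heine_Borel)
      moreover from this have "finite (\<Union>\<D>)"
        by (intro finite_Union) auto
      ultimately show ?thesis
        by (meson finite_subset)
    qed
    have "\<forall>x. \<exists>n. dist (d n) (f x) < \<epsilon>/2"
      using approx[of "\<epsilon>/2"] K(2) by simp
    then obtain n where n: "\<And>x. dist (d (n x)) (f x) < \<epsilon>/2"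
      by metis
    have "(\<lambda>x. {d (g x)}) \<in> U" if "g \<in> cylinder K n" for g
    proof (rule K(3))
      show "(\<lambda>x. {d (g x)}) \<in> MC"
        by (simp add: MC_def minimal_cusco_singletons continuous_on_open_vimage discrete)
      fix x assume "x \<in> K"
      then have "Hausdorff_dist (F x) {d (g x)} \<le> \<epsilon>/2"
        using that n[of x] by (intro Hausdorff_dist_le)
          (auto simp: f cylinder_def dist_commute)
      then show "Hausdorff_dist (F x) {d (g x)} < \<epsilon>"
        using K(2) by simp
    qed
    then show ?thesis
      using \<open>finite K\<close> by blast
  qed
  then obtain K n where Kn: "\<And>U. U \<in> \<U> - {{}} \<Longrightarrow> finite (K U)"
    "\<And>U g. U \<in> \<U> - {{}} \<Longrightarrow> g \<in> cylinder (K U) (n U) \<Longrightarrow> (\<lambda>x. {d (g x)}) \<in> U"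
    by metis
  have "disjoint_family_on (\<lambda>U. cylinder (K U) (n U)) (\<U> - {{}})"
    using Kn(2) disj unfolding disjoint_family_on_def pairwise_def disjnt_def by blast
  then have "countable (\<U> - {{}})"
    using Kn(1) by (intro countable_disjoint_cylinders)
  then show "countable \<U>"
    by (meson countable_Diff_eq countable_empty countable_insert)
qed


section \<open>Minimal cusco maps that jump along the boundary of an open set\<close>

lemma (in locally_convex_tvs) continuous_on_scaleR_left:
  fixes y :: 'b
  shows "continuous_on UNIV (\<lambda>r::real. r *\<^sub>R y)"
proof -
  have "continuous_on UNIV (\<lambda>r::real. (\<lambda>(c, y). scale c y) (of_real r, y))"
    by (rule continuous_on_compose2[OF continuous_scale]) (auto intro!: continuous_intros)
  then show ?thesis
    by (simp add: scale_of_real)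
qed

lemma segment_0_eq_image: "closed_segment 0 y = (\<lambda>t. t *\<^sub>R y) ` {0..1}"
  by (auto simp: closed_segment_def)

text \<open>The value at \<open>x\<close> is the closed convex hull of the cluster values at \<open>x\<close> of the function that
  is \<open>y\<close> on \<open>G\<close> and \<open>0\<close> on the complement of \<open>closure G\<close>. Using the complement of the closure,
  rather than that of \<open>G\<close>, keeps the map minimal at points of \<open>interior (closure G)\<close> outside
  \<open>G\<close>, where the value must be \<open>{y}\<close> alone.\<close>

definition jump_map ::
    "'b::real_vector \<Rightarrow> 'a::topological_space set \<Rightarrow> 'a \<Rightarrow> 'b set"
  where "jump_map y G x = convex hull
    ((if x \<in> closure G then {y} else {}) \<union> (if x \<in> closure (- closure G) then {0} else {}))"

text \<open>In the first two cases the point lies in an open set on which the map is constant, and in the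
  third the value is as large as it can be; this is what upper semicontinuity rests on.\<close>

lemma jump_map_cases:
  obtains "x \<in> - closure G" "jump_map y G x = {0}"
  | "x \<in> interior (closure G)" "jump_map y G x = {y}"
  | "jump_map y G x = closed_segment 0 y"
proof -
  have "- closure (- closure G) = interior (closure G)"
    by (simp add: closure_complement)
  then show ?thesis
    using that closure_subset[of "- closure G"] interior_subset[of "closure G"]
    by (cases "x \<in> closure G"; cases "x \<in> closure (- closure G)")
      (auto simp: jump_map_def segment_convex_hull insert_commute)
qed

lemma jump_map_subset_segment: "jump_map y G x \<subseteq> closed_segment 0 y"
  by (rule jump_map_cases[of x G y]) auto

lemma jump_map_in_interior: "x \<in> interior (closure G) \<Longrightarrow> jump_map y G x = {y}"
  using interior_subset[of "closure G"]
  by (auto simp: jump_map_def closure_complement)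

lemma jump_map_outside: "x \<in> - closure G \<Longrightarrow> jump_map y G x = {0}"
  using closure_subset[of "- closure G"] by (auto simp: jump_map_def)

lemma cusco_jump_map:
  fixes y :: "'b::{real_vector, metric_space}"
  assumes "continuous_on UNIV (\<lambda>r::real. r *\<^sub>R y)"
  shows "cusco (jump_map y G)"
proof -
  have "compact (closed_segment 0 y)"
    unfolding segment_0_eq_image
    by (intro compact_continuous_image continuous_on_subset[OF assms]) auto
  then have "compact (jump_map y G x) \<and> jump_map y G x \<noteq> {}" for x
    by (rule_tac jump_map_cases[of x G y]) auto
  moreover have "\<exists>U. open U \<and> x \<in> U \<and> (\<Union>x'\<in>U. jump_map y G x') \<subseteq> V"
    if "open V \<and> jump_map y G x \<subseteq> V" for x V
  proof (cases rule: jump_map_cases[of x G y])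
    case 1
    then show ?thesis
      using that by (intro exI[of _ "- closure G"]) (auto simp: jump_map_outside)
  next
    case 2
    then show ?thesis
      using that by (intro exI[of _ "interior (closure G)"]) (auto simp: jump_map_in_interior)
  next
    case 3
    then show ?thesis
      using that jump_map_subset_segment[of y G] by (intro exI[of _ UNIV]) auto
  qed
  ultimately show ?thesis
    by (auto simp: cusco_def usco_def upper_semicontinuous_def jump_map_def)
qed

text \<open>If \<open>z\<close> were not a value at \<open>x\<close>, then by upper semicontinuity, applied to the complement of
  \<open>z\<close>, it would not be a value at nearby points either; but nearby points of \<open>S\<close> have no
  value other than \<open>z\<close>, and values exist.\<close>

lemma usco_closure_value:
  fixes H :: "'a::topological_space \<Rightarrow> 'b::t1_space set"
  assumes H: "usco H" and z: "\<And>x. x \<in> S \<Longrightarrow> H x \<subseteq> {z}" and x: "x \<in> closure S"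
  shows "z \<in> H x"
proof (rule ccontr)
  assume "z \<notin> H x"
  then have "H x \<subseteq> - {z}"
    by blast
  moreover have "open (- {z})"
    by auto
  ultimately obtain U where U: "open U" "x \<in> U" "(\<Union>x'\<in>U. H x') \<subseteq> - {z}"
    using H unfolding usco_def upper_semicontinuous_def by blast
  then obtain x' where "x' \<in> S" "x' \<in> U"
    using x by (meson closure_iff_nhds_not_empty disjoint_iff subset_refl)
  then have "H x' = {}"
    using U(3) z by blast
  then show False
    using H by (simp add: usco_def)
qed

text \<open>A cusco map \<open>H\<close> below \<open>jump_map y G\<close> is forced to be \<open>{y}\<close> on \<open>G\<close> and \<open>{0}\<close> off
  \<open>closure G\<close>. By the preceding lemma it keeps these values on the closures of the two sets, and
  then convexity gives the whole of \<open>jump_map y G\<close>.\<close>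

lemma minimal_cusco_jump_map:
  fixes y :: "'b::{real_vector, metric_space}"
  assumes cont: "continuous_on UNIV (\<lambda>r::real. r *\<^sub>R y)" and G: "open G"
  shows "minimal_cusco (jump_map y G)"
  unfolding minimal_cusco_def
proof
  show "cusco (jump_map y G)"
    by (rule cusco_jump_map[OF cont])
  have G_sub: "G \<subseteq> interior (closure G)"
    using G closure_subset by (rule interior_maximal[rotated])
  show "\<not> (\<exists>H. cusco H \<and> map_graph H \<subset> map_graph (jump_map y G))"
  proof (rule notI, elim exE conjE)
    fix H assume H: "cusco H" "map_graph H \<subset> map_graph (jump_map y G)"
    have sub: "H x \<subseteq> jump_map y G x" for x
      using H(2) by (auto simp: map_graph_def)
    have usco: "usco H"
      using H(1) by (simp add: cusco_def)
    have "jump_map y G x \<subseteq> H x" for x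
    proof -
      have "y \<in> H x" if "x \<in> closure G"
        using usco _ that
      proof (rule usco_closure_value)
        show "H x' \<subseteq> {y}" if "x' \<in> G" for x'
          using sub[of x'] jump_map_in_interior[of x' G y] G_sub that by auto
      qed
      moreover have "0 \<in> H x" if "x \<in> closure (- closure G)"
        using usco _ that
      proof (rule usco_closure_value)
        show "H x' \<subseteq> {0}" if "x' \<in> - closure G" for x'
          using sub[of x'] jump_map_outside[OF that, of y] by auto
      qed
      ultimately show ?thesis
        using H(1) unfolding jump_map_def cusco_def by (intro hull_minimal) auto
    qed
    then have "H = jump_map y G"
      using sub by blast
    then show False
      using H(2) by blast
  qed
qed


section \<open>Non-discrete spaces\<close>

text \<open>Every open neighbourhood \<open>U\<close> of the limit point contains another point, and separating the
  two cuts \<open>U\<close> into a smaller neighbourhood \<open>U'\<close> of the limit point and a disjoint nonempty open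
  set \<open>V\<close>. Iterating on \<open>U'\<close> yields the sequence.\<close>

lemma disjoint_open_sequence_at_limit_point:
  fixes x0 :: "'a::t2_space"
  assumes "\<not> open {x0}" "open W" "x0 \<in> W"
  obtains V :: "nat \<Rightarrow> 'a set" where "\<And>n. open (V n)" "\<And>n. V n \<noteq> {}" "\<And>n. V n \<subseteq> W"
    "disjoint_family V"
proof -
  define P where "P = (\<lambda>U::'a set. open U \<and> x0 \<in> U \<and> U \<subseteq> W)"
  have split: "\<exists>U' V. P U' \<and> U' \<subseteq> U \<and> open V \<and> V \<noteq> {} \<and> V \<subseteq> U \<and> V \<inter> U' = {}" if "P U" for U
  proof -
    have "U \<noteq> {x0}"
      using that assms(1) by (auto simp: P_def)
    then obtain x where x: "x \<in> U" "x \<noteq> x0"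
      using \<open>P U\<close> by (auto simp: P_def)
    then obtain A B where "open A" "open B" "x0 \<in> A" "x \<in> B" "A \<inter> B = {}"
      using hausdorff[of x0 x] by metis
    then show ?thesis
      using that x by (intro exI[of _ "A \<inter> U"] exI[of _ "B \<inter> U"]) (auto simp: P_def)
  qed
  then obtain next_nbhd cut where step: "\<And>U. P U \<Longrightarrow> P (next_nbhd U) \<and> next_nbhd U \<subseteq> U \<and>
      open (cut U) \<and> cut U \<noteq> {} \<and> cut U \<subseteq> U \<and> cut U \<inter> next_nbhd U = {}"
    by metis
  define U where "U = (\<lambda>n. (next_nbhd ^^ n) W)"
  have P: "P (U n)" for n
    by (induction n) (use assms(2,3) step in \<open>auto simp: U_def P_def\<close>)
  have Suc: "U (Suc n) = next_nbhd (U n)" for n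
    by (simp add: U_def)
  have mono: "U n \<subseteq> U m" if "m \<le> n" for m n
    using that by (rule lift_Suc_antimono_le[of U, rotated]) (simp add: Suc step P)
  have disj: "cut (U m) \<inter> cut (U n) = {}" if "m < n" for m n
    using step[OF P[of m]] step[OF P[of n]] mono[of "Suc m" n] that by (auto simp: Suc)
  show ?thesis
  proof (rule that[of "\<lambda>n. cut (U n)"])
    show "disjoint_family (\<lambda>n. cut (U n))"
      unfolding disjoint_family_on_def by (metis disj inf_commute linorder_neqE_nat)
    fix n
    show "open (cut (U n))" "cut (U n) \<noteq> {}" "cut (U n) \<subseteq> W"
      using step[OF P[of n]] P[of n] by (auto simp: P_def)
  qed
qed

lemma uncountable_UNIV_nat_set: "uncountable (UNIV :: nat set set)"
  by (metis Cantors_theorem Pow_UNIV UNIV_not_empty empty_not_UNIV uncountable_def)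

text \<open>Every neighbourhood of the constant map \<open>x \<mapsto> {0}\<close> contains jump maps indexed by all sets of
  natural numbers, separated from each other by disjoint open sets. Scaling \<open>a\<close> down
  brings the maps into the given neighbourhood. The points \<open>p n\<close> at which they are told apart stay
  in one compact set \<open>L\<close>, so that closeness on \<open>L\<close> controls all of them at once.\<close>

lemma locally_ccc_MC_space_imp_discrete:
  fixes a :: "'b::{real_vector, metric_space}"
  assumes X: "locally_compact_space (euclidean :: 'a::t2_space topology)"
    and cont: "\<And>y::'b. continuous_on UNIV (\<lambda>r::real. r *\<^sub>R y)"
    and a: "a \<noteq> 0"
    and ccc: "locally_ccc_space (MC_space :: ('a \<Rightarrow> 'b set) topology)"
  shows "open {x0 :: 'a}"
proof (rule ccontr)
  assume "\<not> open {x0}"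
  obtain W L where L: "open W" "compact L" "x0 \<in> W" "W \<subseteq> L"
    using X by (simp add: locally_compact_space_def) metis
  obtain V :: "nat \<Rightarrow> 'a set" where V: "\<And>n. open (V n)" "\<And>n. V n \<noteq> {}" "\<And>n. V n \<subseteq> W"
    "disjoint_family V"
    using disjoint_open_sequence_at_limit_point[OF \<open>\<not> open {x0}\<close> L(1,3)] by blast
  define zero where "zero = (jump_map 0 {} :: 'a \<Rightarrow> 'b set)"
  have zero: "zero x = {0}" for x
    by (simp add: zero_def jump_map_def)
  have "zero \<in> MC"
    unfolding zero_def MC_def using minimal_cusco_jump_map[OF cont] by blast
  then obtain U N where U: "openin MC_space U" "zero \<in> U" "U \<subseteq> N"
    and N: "N \<subseteq> MC" "ccc_space (subtopology MC_space N)"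
    using ccc unfolding locally_ccc_space_def topspace_MC_space by blast
  obtain K \<epsilon> where K: "compact K" "\<epsilon> > 0"
    "\<And>G. G \<in> MC \<Longrightarrow> (\<And>x. x \<in> K \<Longrightarrow> Hausdorff_dist (zero x) (G x) < \<epsilon>) \<Longrightarrow> G \<in> U"
    using openin_MC_spaceE[OF U(1,2)] by metis
  have "isCont (\<lambda>r::real. r *\<^sub>R a) 0"
    using cont[of a] by (simp add: continuous_on_eq_continuous_at)
  then obtain \<delta> where \<delta>: "\<delta> > 0" "\<And>r. \<bar>r\<bar> < \<delta> \<Longrightarrow> dist (r *\<^sub>R a) 0 < \<epsilon>/2"
    using K(2) unfolding continuous_at_eps_delta
    by (metis half_gt_zero dist_0_norm dist_commute real_norm_def scaleR_zero_left)
  define y where "y = (\<delta>/2) *\<^sub>R a"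
  have "y \<noteq> 0"
    using a \<delta>(1) by (simp add: y_def)
  have near: "dist 0 z \<le> \<epsilon>/2" if z: "z \<in> closed_segment 0 y" for z
  proof -
    obtain t where t: "0 \<le> t" "t \<le> 1" "z = (t * (\<delta>/2)) *\<^sub>R a"
      using z by (auto simp: segment_0_eq_image y_def)
    have "\<bar>t * (\<delta>/2)\<bar> < \<delta>"
      using t \<delta>(1) mult_right_mono[of t 1 "\<delta>/2"] by (simp add: abs_mult)
    then show ?thesis
      using \<delta>(2) t(3) by (metis dist_commute less_imp_le)
  qed
  define F where "F = (\<lambda>A. jump_map y (\<Union>n\<in>A. V n))"
  have MC: "F A \<in> MC" for A
    unfolding F_def MC_def using minimal_cusco_jump_map[OF cont] V(1) by blast
  have FU: "F A \<in> U" for A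
  proof (rule K(3)[OF MC])
    fix x
    have "F A x \<noteq> {}" "F A x \<subseteq> closed_segment 0 y"
      using MC[of A] MC_subset_compact_valued_maps jump_map_subset_segment[of y "\<Union>n\<in>A. V n" x]
      by (auto simp: compact_valued_maps_def F_def)
    then have "Hausdorff_dist (zero x) (F A x) \<le> \<epsilon>/2"
      using near by (intro Hausdorff_dist_le) (auto simp: zero)
    then show "Hausdorff_dist (zero x) (F A x) < \<epsilon>"
      using K(2) by simp
  qed
  have "\<forall>n. \<exists>x. x \<in> V n"
    using V(2) by auto
  then obtain p where p: "\<And>n. p n \<in> V n"
    by metis
  have F_in: "F A (p n) = {y}" if "n \<in> A" for A n
  proof -
    have "V n \<subseteq> interior (closure (\<Union>n\<in>A. V n))"
      using that V(1) closure_subset[of "\<Union>n\<in>A. V n"] by (intro interior_maximal) auto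
    then show ?thesis
      unfolding F_def using p by (intro jump_map_in_interior) auto
  qed
  have F_out: "F A (p n) = {0}" if "n \<notin> A" for A n
  proof -
    have "V n \<inter> V m = {}" if "m \<in> A" for m
    proof (rule disjoint_family_onD[OF V(4)])
      show "n \<noteq> m"
        using that \<open>n \<notin> A\<close> by blast
    qed auto
    then have "V n \<inter> (\<Union>n\<in>A. V n) = {}"
      by blast
    then have "V n \<inter> closure (\<Union>n\<in>A. V n) = {}"
      by (subst open_Int_closure_eq_empty[OF V(1)])
    then have "p n \<in> - closure (\<Union>n\<in>A. V n)"
      using p[of n] by blast
    then show ?thesis
      unfolding F_def by (rule jump_map_outside)
  qed
  \<comment> \<open>No point is within \<open>r\<close> of both \<open>y\<close> and \<open>0\<close>, so tubes of radius \<open>r\<close> around functions that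
    take these two different values at some \<open>p n\<close> are disjoint.\<close>
  define r where "r = dist y 0 / 2"
  have "r > 0"
    using \<open>y \<noteq> 0\<close> by (simp add: r_def)
  \<comment> \<open>On the points \<open>p n\<close>, the only ones that matter, the map \<open>F A\<close> is single-valued with
    value \<open>f A\<close>.\<close>
  define f where "f = (\<lambda>A x. if x \<in> p ` A then y else 0)"
  have p_inj: "p n \<in> p ` A \<longleftrightarrow> n \<in> A" for n A
  proof -
    have "m = n" if "p n = p m" for m
      using disjoint_family_onD[OF V(4), of m n] p[of n] p[of m] that by auto
    then show ?thesis
      by blast
  qed
  define T where "T = (\<lambda>A. uniform_tube (range p) r (f A) \<inter> U)"
  have open_T: "openin (subtopology MC_space N) (T A)" for A
  proof -
    have "range p \<subseteq> L"
      using p V(3) L(4) by blast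
    then have "openin MC_space (T A)"
      using openin_uniform_tube[OF _ L(2), of "range p" r "f A"] U(1)
      unfolding T_def MC_space_def openin_subtopology by blast
    moreover have "T A \<subseteq> N"
      using U(3) by (auto simp: T_def)
    ultimately show ?thesis
      unfolding openin_subtopology by blast
  qed
  have F_T: "F A \<in> T A" for A
  proof -
    have "dist q (f A x) \<le> r - r" if x: "x \<in> range p" and q: "q \<in> F A x" for x q
    proof -
      obtain n where n: "x = p n"
        using x by blast
      then have "F A x = {f A x}"
        using F_in[of n A] F_out[of n A] p_inj[of n A] by (cases "n \<in> A") (simp_all add: f_def)
      then show ?thesis
        using q by simp
    qed
    then show ?thesis
      using FU[of A] MC[of A] MC_subset_compact_valued_maps \<open>r > 0\<close>
      by (auto simp: T_def uniform_tube_def)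
  qed
  have disj: "T A \<inter> T B = {}" if "n \<in> A" "n \<notin> B" for A B n
  proof (rule ccontr)
    assume "T A \<inter> T B \<noteq> {}"
    then obtain G where G: "G \<in> uniform_tube (range p) r (f A)" "G \<in> uniform_tube (range p) r (f B)"
      by (auto simp: T_def)
    have "G (p n) \<noteq> {}"
      using G(1) by (simp add: uniform_tube_def compact_valued_maps_def)
    then obtain q where q: "q \<in> G (p n)"
      by blast
    have "dist q (f A (p n)) < r" "dist q (f B (p n)) < r"
      using G q by (force simp: uniform_tube_def)+
    then have "dist q y < r" "dist q 0 < r"
      using that by (auto simp: f_def p_inj)
    then show False
      using dist_triangle2[of y 0 q] by (simp add: r_def dist_commute)
  qed
  have disj': "T A \<inter> T B = {}" if neq: "A \<noteq> B" for A B
  proof -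
    obtain n where "n \<in> A \<and> n \<notin> B \<or> n \<in> B \<and> n \<notin> A"
      using neq by blast
    then show ?thesis
      using disj[of n A B] disj[of n B A] by blast
  qed
  have "pairwise disjnt (range T)"
  proof (rule pairwiseI)
    fix P Q assume "P \<in> range T" "Q \<in> range T" and "P \<noteq> Q"
    then obtain A B where AB: "P = T A" "Q = T B"
      by auto
    with \<open>P \<noteq> Q\<close> have "A \<noteq> B"
      by auto
    then show "disjnt P Q"
      unfolding disjnt_def AB by (rule disj')
  qed
  moreover have "\<forall>S\<in>range T. openin (subtopology MC_space N) S"
    using open_T by simp
  ultimately have "countable (range T)"
    using N(2) unfolding ccc_space_def by simp
  moreover have "inj T"
  proof (rule injI, rule ccontr)
    fix A B assume "T A = T B" "A \<noteq> B"
    then show False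
      using disj'[of A B] F_T[of A] by blast
  qed
  ultimately show False
    using uncountable_UNIV_nat_set countable_image_inj_eq[of T UNIV] by simp
qed


section \<open>The equivalence\<close>

lemma ccc_imp_locally_ccc_space: "ccc_space Z \<Longrightarrow> locally_ccc_space Z"
  unfolding locally_ccc_space_def by (metis openin_topspace subset_refl subtopology_topspace)

theorem theorem4p3:
  fixes scale :: "'k::real_or_complex \<Rightarrow> 'b::{real_vector, metric_space} \<Rightarrow> 'b"
  assumes X_locally_compact: "locally_compact_space (euclidean :: 'a::t2_space topology)"
    and Y_locally_convex: "locally_convex_tvs scale"
    and Y_two_points: "\<exists>y z :: 'b. y \<noteq> z"
    and Y_separable: "separable_space (euclidean :: 'b topology)"
  shows "(ccc_space (MC_space :: ('a \<Rightarrow> 'b set) topology)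
            \<longleftrightarrow> locally_ccc_space (MC_space :: ('a \<Rightarrow> 'b set) topology))
       \<and> (locally_ccc_space (MC_space :: ('a \<Rightarrow> 'b set) topology)
            \<longleftrightarrow> (euclidean :: 'a topology) = discrete_topology UNIV)"
proof -
  obtain a :: 'b where a: "a \<noteq> 0"
    using Y_two_points by metis
  have "(euclidean :: 'a topology) = discrete_topology UNIV"
    if "locally_ccc_space (MC_space :: ('a \<Rightarrow> 'b set) topology)"
    using locally_ccc_MC_space_imp_discrete[OF X_locally_compact
        locally_convex_tvs.continuous_on_scaleR_left[OF Y_locally_convex] a that]
    by (subst eq_commute) (simp add: discrete_topology_unique)
  moreover have "ccc_space (MC_space :: ('a \<Rightarrow> 'b set) topology)"
    if "(euclidean :: 'a topology) = discrete_topology UNIV"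
  proof (rule discrete_imp_ccc_MC_space[OF _ Y_separable])
    show "open S" for S :: "'a set"
      using that by (metis open_openin openin_discrete_topology subset_UNIV)
  qed
  ultimately show ?thesis
    using ccc_imp_locally_ccc_space by blast
qed

end
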